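(* Let $G$ and $H$ be finite simple graphs and let $\varphi(g_1,g_2,h_1,h_2)$ be a logical formula built from the atomic formulas $g_1g_2\in E(G)$, $h_1h_2\in E(H)$, $g_1=g_2$, $h_1=h_2$ using the connectives $\wedge,\vee,\neg,\Rightarrow$. Suppose that $\varphi$ satisfies \[ \bigl((h_1=h_2)\wedge\neg(g_1g_2\in E(G))\bigr)\Rightarrow\neg\varphi(g_1,g_2,h_1,h_2) \] for all $g_1,g_2\in V(G)$ and $h_1,h_2\in V(H)$. If $G$ is opposable, then $G\varphi H$ is opposable.
   Context: All graphs are finite and simple. $N[v]$ denotes the closed neighbourhood of $v$. An opposition of a graph $G$ is an automorphism $f$ of $G$ of order two, in the sense $f\circ f=\mathrm{id}$, such that $f(v)\notin N[v]$ for all $v\in V(G)$. A graph is opposable if it has an opposition (the empty graph is vacuously opposable). For a formula $\varphi$ as in the claim, $G\varphi H$ denotes the graph with vertex set $V(G)\times V(H)$ in which $(g_1,h_1)(g_2,h_2)$ is an edge if and only if $\varphi(g_1,g_2,h_1,h_2)$ holds. *)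

theory Defs
  imports "Graph_Theory.Pair_Digraph"
begin

text \<open>
  A finite simple graph is a \<open>pair_graph\<close>: a finite, loop-free digraph without parallel arcs whose
  arc relation is symmetric; an edge \<open>uv\<close> is represented by the two arcs \<open>(u, v)\<close> and \<open>(v, u)\<close>.
\<close>

definition closed_nbhd :: "'a pair_pre_digraph \<Rightarrow> 'a \<Rightarrow> 'a set" where
  "closed_nbhd G v = insert v {u \<in> pverts G. (v, u) \<in> parcs G}"

definition automorphism :: "'a pair_pre_digraph \<Rightarrow> ('a \<Rightarrow> 'a) \<Rightarrow> bool" where
  "automorphism G f \<longleftrightarrow>
     bij_betw f (pverts G) (pverts G) \<and>
     (\<forall>u\<in>pverts G. \<forall>v\<in>pverts G. (f u, f v) \<in> parcs G \<longleftrightarrow> (u, v) \<in> parcs G)"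

text \<open>
  ``Order two'' means only \<open>f \<circ> f = id\<close> on the vertices, so the empty graph has an opposition.
\<close>

definition opposition :: "'a pair_pre_digraph \<Rightarrow> ('a \<Rightarrow> 'a) \<Rightarrow> bool" where
  "opposition G f \<longleftrightarrow>
     automorphism G f \<and>
     (\<forall>v\<in>pverts G. f (f v) = v) \<and>
     (\<forall>v\<in>pverts G. f v \<notin> closed_nbhd G v)"

definition opposable :: "'a pair_pre_digraph \<Rightarrow> bool" where
  "opposable G \<longleftrightarrow> (\<exists>f. opposition G f)"

text \<open>
  The atoms \<open>AdjG\<close>, \<open>AdjH\<close>, \<open>EqG\<close>, \<open>EqH\<close> stand for \<open>g1 g2 \<in> E(G)\<close>, \<open>h1 h2 \<in> E(H)\<close>, \<open>g1 = g2\<close> and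
  \<open>h1 = h2\<close>.
\<close>

datatype prod_formula =
    AdjG | AdjH | EqG | EqH
  | Conj prod_formula prod_formula
  | Disj prod_formula prod_formula
  | Neg prod_formula
  | Impl prod_formula prod_formula

primrec holds ::
  "'a pair_pre_digraph \<Rightarrow> 'b pair_pre_digraph \<Rightarrow> prod_formula \<Rightarrow> 'a \<Rightarrow> 'a \<Rightarrow> 'b \<Rightarrow> 'b \<Rightarrow> bool"
where
  "holds G H AdjG g1 g2 h1 h2 \<longleftrightarrow> (g1, g2) \<in> parcs G"
| "holds G H AdjH g1 g2 h1 h2 \<longleftrightarrow> (h1, h2) \<in> parcs H"
| "holds G H EqG g1 g2 h1 h2 \<longleftrightarrow> g1 = g2"
| "holds G H EqH g1 g2 h1 h2 \<longleftrightarrow> h1 = h2"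
| "holds G H (Conj p q) g1 g2 h1 h2 \<longleftrightarrow> holds G H p g1 g2 h1 h2 \<and> holds G H q g1 g2 h1 h2"
| "holds G H (Disj p q) g1 g2 h1 h2 \<longleftrightarrow> holds G H p g1 g2 h1 h2 \<or> holds G H q g1 g2 h1 h2"
| "holds G H (Neg p) g1 g2 h1 h2 \<longleftrightarrow> \<not> holds G H p g1 g2 h1 h2"
| "holds G H (Impl p q) g1 g2 h1 h2 \<longleftrightarrow> (holds G H p g1 g2 h1 h2 \<longrightarrow> holds G H q g1 g2 h1 h2)"

definition formula_product ::
  "'a pair_pre_digraph \<Rightarrow> prod_formula \<Rightarrow> 'b pair_pre_digraph \<Rightarrow> ('a \<times> 'b) pair_pre_digraph"
where
  "formula_product G \<phi> H =
     \<lparr> pverts = pverts G \<times> pverts H,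
       parcs = {((g1, h1), (g2, h2)) | g1 h1 g2 h2.
                  g1 \<in> pverts G \<and> g2 \<in> pverts G \<and> h1 \<in> pverts H \<and> h2 \<in> pverts H \<and>
                  holds G H \<phi> g1 g2 h1 h2} \<rparr>"

text \<open>
  For an arbitrary formula the product may have loops (e.g.\ for \<open>EqG\<close>). It is always symmetric,
  since all atoms are, and the condition on \<open>\<phi>\<close> below, taken at \<open>g1 = g2\<close>, excludes loops. Hence
  the product is again a finite simple graph.
\<close>

lemma holds_swap:
  assumes "pair_graph G" "pair_graph H"
  shows "holds G H \<phi> g1 g2 h1 h2 \<longleftrightarrow> holds G H \<phi> g2 g1 h2 h1"
proof -
  interpret G: pair_graph G by fact
  interpret H: pair_graph H by fact
  show ?thesis
    by (induction \<phi>) (auto dest: G.arcs_symmetric H.arcs_symmetric)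
qed

lemma pair_graph_formula_product:
  assumes G: "pair_graph G" and H: "pair_graph H"
    and \<phi>: "\<And>g1 g2 h1 h2.
      \<lbrakk>g1 \<in> pverts G; g2 \<in> pverts G; h1 \<in> pverts H; h2 \<in> pverts H;
       h1 = h2 \<and> (g1, g2) \<notin> parcs G\<rbrakk> \<Longrightarrow> \<not> holds G H \<phi> g1 g2 h1 h2"
  shows "pair_graph (formula_product G \<phi> H)"
proof -
  interpret G: pair_graph G by fact
  interpret H: pair_graph H by fact
  let ?P = "formula_product G \<phi> H"
  have fin: "finite (pverts ?P)"
    using G.pair_finite_verts H.pair_finite_verts by (simp add: formula_product_def)
  have sub: "parcs ?P \<subseteq> pverts ?P \<times> pverts ?P"
    by (auto simp: formula_product_def)
  have sym: "sym (parcs ?P)"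
    using holds_swap[OF G H] by (auto simp: formula_product_def sym_def)
  have irr: "fst e \<noteq> snd e" if "e \<in> parcs ?P" for e
    using that \<phi> G.no_loops' by (fastforce simp: formula_product_def)
  show ?thesis
    using fin finite_subset[OF sub] sub sym irr
    by unfold_locales (auto simp: symmetric_def)
qed

end

theory Submission
  imports Defs
begin

text \<open>Let an opposition f of G act on the first coordinate and fix the second: (g, h) goes to
  (f g, h). Whether \<phi> holds depends only on the truth of its four atoms, and an automorphism of
  G preserves those about G while the ones about H are untouched; so this map is an automorphism
  (\<open>automorphism_map_prod_id\<close>), and it inherits the involution property from f. A
  vertex and its image share h, while g and f g are distinct and non-adjacent: exactly the situation
  in which the condition on \<phi> forbids an edge.\<close>

lemma holds_image:
  assumes "(f g1, f g2) \<in> parcs G \<longleftrightarrow> (g1, g2) \<in> parcs G" and "f g1 = f g2 \<longleftrightarrow> g1 = g2"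
  shows "holds G H \<phi> (f g1) (f g2) h1 h2 \<longleftrightarrow> holds G H \<phi> g1 g2 h1 h2"
  using assms by (induction \<phi>) auto

lemma automorphism_map_prod_id:
  assumes "automorphism G f"
  shows "automorphism (formula_product G \<phi> H) (map_prod f id)"
proof -
  have bij: "bij_betw f (pverts G) (pverts G)"
    and arc: "\<And>u v. \<lbrakk>u \<in> pverts G; v \<in> pverts G\<rbrakk> \<Longrightarrow> (f u, f v) \<in> parcs G \<longleftrightarrow> (u, v) \<in> parcs G"
    using assms by (auto simp: automorphism_def)
  have "holds G H \<phi> (f u) (f v) h1 h2 \<longleftrightarrow> holds G H \<phi> u v h1 h2"
    if "u \<in> pverts G" "v \<in> pverts G" for u v h1 h2
    \<comment> \<open>Injectivity of f on the vertices takes care of the atom \<open>EqG\<close>,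
      arc preservation of \<open>AdjG\<close>.\<close>
    using that arc inj_on_eq_iff[OF bij_betw_imp_inj_on[OF bij]] by (intro holds_image) auto
  moreover have "bij_betw (map_prod f id) (pverts G \<times> pverts H) (pverts G \<times> pverts H)"
    using bij by (intro bij_betw_map_prod) auto
  ultimately show ?thesis
    using bij_betwE[OF bij] by (auto simp: automorphism_def formula_product_def)
qed

theorem theorem2p6:
  fixes G :: "'a pair_pre_digraph" and H :: "'b pair_pre_digraph" and \<phi> :: prod_formula
  assumes "pair_graph G" and "pair_graph H"
    and "\<And>g1 g2 h1 h2.
      \<lbrakk>g1 \<in> pverts G; g2 \<in> pverts G; h1 \<in> pverts H; h2 \<in> pverts H;
       h1 = h2 \<and> (g1, g2) \<notin> parcs G\<rbrakk> \<Longrightarrow> \<not> holds G H \<phi> g1 g2 h1 h2"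
    and "opposable G"
  shows "opposable (formula_product G \<phi> H)"
proof -
  obtain f where f: "opposition G f"
    using assms(4) by (auto simp: opposable_def)
  then have aut: "automorphism G f" and inv: "\<And>v. v \<in> pverts G \<Longrightarrow> f (f v) = v"
    and away: "\<And>v. v \<in> pverts G \<Longrightarrow> f v \<notin> closed_nbhd G v"
    by (auto simp: opposition_def)
  \<comment> \<open>\<open>closed_nbhd\<close> collects only vertices, so \<open>away\<close> yields
    that v and f v are non-adjacent once f v is known to be a vertex.\<close>
  have "f v \<in> pverts G" if "v \<in> pverts G" for v
    using aut that by (auto simp: automorphism_def dest: bij_betwE)
  \<comment> \<open>For x = (g, h), equality with the image fails since f g \<noteq> g; adjacency
    fails by the condition on \<phi> at g1 = g, g2 = f g, h1 = h2 = h.\<close>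
  then have "map_prod f id x \<notin> closed_nbhd (formula_product G \<phi> H) x"
    if "x \<in> pverts (formula_product G \<phi> H)" for x
    using that away assms(3) by (fastforce simp: closed_nbhd_def formula_product_def)
  then have "opposition (formula_product G \<phi> H) (map_prod f id)"
    using automorphism_map_prod_id[OF aut] inv
    by (auto simp: opposition_def formula_product_def)
  then show ?thesis
    by (auto simp: opposable_def)
qed

end
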